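(* Let $M$ be a smooth manifold whose tangent bundle admits a decomposition $TM=V\oplus H$ into vector subbundles, with corresponding projectors $v:TM\to V$ and $h:TM\to H$, and let $E=h-v$ be the associated almost product structure. Let $\nabla$ be a linear connection on $M$, and let $T$ and $A$ be the O'Neill–Gray fundamental tensor fields $$T(X,Y)=h(\nabla_{vX}vY)+v(\nabla_{vX}hY),\qquad A(X,Y)=v(\nabla_{hX}hY)+h(\nabla_{hX}vY).$$ Then the structural and virtual tensor fields of $(\nabla,h-v)$ satisfy, for all vector fields $X,Y$, $$C^{h-v}_\nabla(X,Y)=2[T(X,vY)+A(X,hY)],\qquad B^{h-v}_\nabla(X,Y)=-2[T(X,hY)+A(X,vY)].$$
   Context: An almost product structure is an endomorphism $E$ of $TM$ with $E^2=I$, the identity; $(\nabla_XE)Y=\nabla_X(EY)-E(\nabla_XY)$. The structural tensor field of $(\nabla,E)$ is $C^E_\nabla(X,Y):=\frac12[(\nabla_{EX}E)Y+(\nabla_XE)EY]$ and the virtual tensor field is $B^E_\nabla(X,Y):=\frac12[(\nabla_{EX}E)Y-(\nabla_XE)EY]$. Here $\nabla_{hX}vY$ means $\nabla_{hX}(vY)$, etc. *)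

theory Defs
  imports "HOL-Analysis.Analysis" "HOL-Library.Function_Algebras"
begin

section \<open>Pointwise real vector space structure on functions\<close>

instantiation "fun" :: (type, real_vector) real_vector
begin

definition scaleR_fun_def: "r *\<^sub>R f = (\<lambda>x. r *\<^sub>R f x)"

instance
  by standard (simp_all add: scaleR_fun_def fun_eq_iff scaleR_add_right scaleR_add_left)

end

lemma scaleR_fun_apply [simp]: "(r *\<^sub>R f) x = r *\<^sub>R f x"
  by (simp add: scaleR_fun_def)


section \<open>Smooth maps on open subsets of normed spaces\<close>

text \<open>Only meaningful for open \<open>S\<close>. Continuity of all iterated directional derivatives amounts to
  \<open>C\<^sup>n\<close> because the domains used below are finite-dimensional.\<close>

primrec Ck_on :: "nat \<Rightarrow> ('a::real_normed_vector \<Rightarrow> 'b::real_normed_vector) \<Rightarrow> 'a set \<Rightarrow> bool" where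
  "Ck_on 0 f S \<longleftrightarrow> continuous_on S f"
| "Ck_on (Suc n) f S \<longleftrightarrow>
     (\<forall>x\<in>S. f differentiable (at x)) \<and> (\<forall>u. Ck_on n (\<lambda>x. frechet_derivative f (at x) u) S)"

definition smooth_on :: "('a::real_normed_vector \<Rightarrow> 'b::real_normed_vector) \<Rightarrow> 'a set \<Rightarrow> bool" where
  "smooth_on f S \<longleftrightarrow> (\<forall>n. Ck_on n f S)"


section \<open>Smooth manifolds\<close>

text \<open>A chart is a domain together with a coordinate map; the values of the map outside the domain
  are irrelevant.\<close>

type_synonym ('a, 'e) chart = "'a set \<times> ('a \<Rightarrow> 'e)"

definition chart_inv :: "('a, 'e) chart \<Rightarrow> 'e \<Rightarrow> 'a" where
  "chart_inv c = inv_into (fst c) (snd c)"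

definition is_chart :: "'a topology \<Rightarrow> ('a, 'e::euclidean_space) chart \<Rightarrow> bool" where
  "is_chart M c \<longleftrightarrow> openin M (fst c) \<and> open (snd c ` fst c) \<and>
     homeomorphic_map (subtopology M (fst c)) (top_of_set (snd c ` fst c)) (snd c)"

definition transition :: "('a, 'e) chart \<Rightarrow> ('a, 'e) chart \<Rightarrow> 'e \<Rightarrow> 'e" where
  "transition c d = snd d \<circ> chart_inv c"

text \<open>The atlas need not be maximal: adding compatible charts changes the tangent spaces
  below only up to canonical isomorphism.\<close>

definition smooth_manifold :: "'a topology \<Rightarrow> ('a, 'e::euclidean_space) chart set \<Rightarrow> bool" where
  "smooth_manifold M \<A> \<longleftrightarrow>
     Hausdorff_space M \<and> second_countable M \<and>
     (\<forall>c\<in>\<A>. is_chart M c) \<and> (\<Union>c\<in>\<A>. fst c) = topspace M \<and>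
     (\<forall>c\<in>\<A>. \<forall>d\<in>\<A>. smooth_on (transition c d) (snd c ` (fst c \<inter> fst d)))"

definition smooth_function :: "('a, 'e::euclidean_space) chart set \<Rightarrow> ('a \<Rightarrow> real) \<Rightarrow> bool" where
  "smooth_function \<A> f \<longleftrightarrow> (\<forall>c\<in>\<A>. smooth_on (f \<circ> chart_inv c) (snd c ` fst c))"


section \<open>Tangent vectors and vector fields\<close>

text \<open>A tangent vector at \<open>p\<close> is given by its coordinates in every chart around \<open>p\<close>, subject to the
  usual transformation law; it is \<open>0\<close> at all charts not containing \<open>p\<close>. In particular the tangent
  space at a point outside the manifold is \<open>{0}\<close>, so vector fields vanish there.\<close>

type_synonym ('a, 'e) tangent = "('a, 'e) chart \<Rightarrow> 'e"

type_synonym ('a, 'e) vfield = "'a \<Rightarrow> ('a, 'e) tangent"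

definition tangent_space :: "('a, 'e::euclidean_space) chart set \<Rightarrow> 'a \<Rightarrow> ('a, 'e) tangent set" where
  "tangent_space \<A> p = {w.
     (\<forall>c\<in>\<A>. \<forall>d\<in>\<A>. p \<in> fst c \<inter> fst d \<longrightarrow>
        w d = frechet_derivative (transition c d) (at (snd c p)) (w c)) \<and>
     (\<forall>c. \<not> (c \<in> \<A> \<and> p \<in> fst c) \<longrightarrow> w c = 0)}"

definition smooth_section ::
    "('a, 'e::euclidean_space) chart set \<Rightarrow> 'a set \<Rightarrow> ('a, 'e) vfield \<Rightarrow> bool" where
  "smooth_section \<A> W Y \<longleftrightarrow>
     (\<forall>p\<in>W. Y p \<in> tangent_space \<A> p) \<and>
     (\<forall>c\<in>\<A>. smooth_on (\<lambda>x. Y (chart_inv c x) c) (snd c ` (fst c \<inter> W)))"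

definition vector_fields ::
    "'a topology \<Rightarrow> ('a, 'e::euclidean_space) chart set \<Rightarrow> ('a, 'e) vfield set" where
  "vector_fields M \<A> = {Y. (\<forall>p. Y p \<in> tangent_space \<A> p) \<and> smooth_section \<A> (topspace M) Y}"

text \<open>The derivative of \<open>f\<close> along the tangent vector \<open>w\<close> at \<open>p\<close>; the value does not depend on the
  chart chosen.\<close>

definition directional_derivative ::
    "('a, 'e::euclidean_space) chart set \<Rightarrow> 'a \<Rightarrow> ('a, 'e) tangent \<Rightarrow> ('a \<Rightarrow> real) \<Rightarrow> real" where
  "directional_derivative \<A> p w f =
     (let c = (SOME c. c \<in> \<A> \<and> p \<in> fst c)
      in frechet_derivative (f \<circ> chart_inv c) (at (snd c p)) (w c))"


section \<open>Linear connections\<close>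

type_synonym ('a, 'e) connection = "('a, 'e) vfield \<Rightarrow> ('a, 'e) vfield \<Rightarrow> ('a, 'e) vfield"

definition linear_connection ::
    "'a topology \<Rightarrow> ('a, 'e::euclidean_space) chart set \<Rightarrow>
     ('a, 'e) connection \<Rightarrow> bool" where
  "linear_connection M \<A> nabla \<longleftrightarrow>
     (\<forall>X\<in>vector_fields M \<A>. \<forall>Y\<in>vector_fields M \<A>. nabla X Y \<in> vector_fields M \<A>) \<and>
     (\<forall>X\<in>vector_fields M \<A>. \<forall>X'\<in>vector_fields M \<A>. \<forall>Y\<in>vector_fields M \<A>.
        nabla (X + X') Y = nabla X Y + nabla X' Y) \<and>
     (\<forall>X\<in>vector_fields M \<A>. \<forall>Y\<in>vector_fields M \<A>. \<forall>Y'\<in>vector_fields M \<A>.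
        nabla X (Y + Y') = nabla X Y + nabla X Y') \<and>
     (\<forall>f. smooth_function \<A> f \<longrightarrow> (\<forall>X\<in>vector_fields M \<A>. \<forall>Y\<in>vector_fields M \<A>.
        nabla (\<lambda>p. f p *\<^sub>R X p) Y = (\<lambda>p. f p *\<^sub>R nabla X Y p) \<and>
        nabla X (\<lambda>p. f p *\<^sub>R Y p) =
          (\<lambda>p. directional_derivative \<A> p (X p) f *\<^sub>R Y p + f p *\<^sub>R nabla X Y p)))"


section \<open>Subbundles of the tangent bundle and their projectors\<close>

text \<open>A subbundle has smooth local frames; its rank is thus locally constant, and \<open>0\<close> is allowed.\<close>

definition vector_subbundle ::
    "'a topology \<Rightarrow> ('a, 'e::euclidean_space) chart set \<Rightarrow> ('a \<Rightarrow> ('a, 'e) tangent set) \<Rightarrow> bool" where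
  "vector_subbundle M \<A> D \<longleftrightarrow>
     (\<forall>p\<in>topspace M. \<exists>W k F. openin M W \<and> p \<in> W \<and>
        (\<forall>i<k. smooth_section \<A> W (F i)) \<and>
        (\<forall>q\<in>W. inj_on (\<lambda>i. F i q) {..<k::nat} \<and>
               independent ((\<lambda>i. F i q) ` {..<k}) \<and>
               span ((\<lambda>i. F i q) ` {..<k}) = D q))"

definition tangent_decomposition ::
    "'a topology \<Rightarrow> ('a, 'e::euclidean_space) chart set \<Rightarrow>
     ('a \<Rightarrow> ('a, 'e) tangent set) \<Rightarrow> ('a \<Rightarrow> ('a, 'e) tangent set) \<Rightarrow> bool" where
  "tangent_decomposition M \<A> V H \<longleftrightarrow>
     vector_subbundle M \<A> V \<and> vector_subbundle M \<A> H \<and>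
     (\<forall>p\<in>topspace M. V p \<inter> H p = {0} \<and> {a + b | a b. a \<in> V p \<and> b \<in> H p} = tangent_space \<A> p)"

text \<open>Bundle endomorphisms of the tangent bundle are given fibrewise.\<close>

type_synonym ('a, 'e) endo = "'a \<Rightarrow> ('a, 'e) tangent \<Rightarrow> ('a, 'e) tangent"

definition projector ::
    "'a topology \<Rightarrow> ('a \<Rightarrow> ('a, 'e::euclidean_space) tangent set) \<Rightarrow>
     ('a \<Rightarrow> ('a, 'e) tangent set) \<Rightarrow> ('a, 'e) endo" where
  "projector M V H p w = (if p \<in> topspace M then THE a. a \<in> V p \<and> w - a \<in> H p else 0)"

definition endo_app :: "('a, 'e) endo \<Rightarrow> ('a, 'e) vfield \<Rightarrow> ('a, 'e) vfield"  (infixr "\<cdot>" 90) where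
  "E \<cdot> Y = (\<lambda>p. E p (Y p))"


section \<open>Structural, virtual and fundamental tensor fields\<close>

definition nabla_endo ::
    "('a, 'e::euclidean_space) connection \<Rightarrow> ('a, 'e) endo \<Rightarrow>
     ('a, 'e) vfield \<Rightarrow> ('a, 'e) vfield \<Rightarrow> ('a, 'e) vfield" where
  "nabla_endo nabla E X Y = nabla X (E \<cdot> Y) - E \<cdot> nabla X Y"

definition structural_tensor ::
    "('a, 'e::euclidean_space) connection \<Rightarrow> ('a, 'e) endo \<Rightarrow>
     ('a, 'e) vfield \<Rightarrow> ('a, 'e) vfield \<Rightarrow> ('a, 'e) vfield" where
  "structural_tensor nabla E X Y =
     (1 / 2) *\<^sub>R (nabla_endo nabla E (E \<cdot> X) Y + nabla_endo nabla E X (E \<cdot> Y))"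

definition virtual_tensor ::
    "('a, 'e::euclidean_space) connection \<Rightarrow> ('a, 'e) endo \<Rightarrow>
     ('a, 'e) vfield \<Rightarrow> ('a, 'e) vfield \<Rightarrow> ('a, 'e) vfield" where
  "virtual_tensor nabla E X Y =
     (1 / 2) *\<^sub>R (nabla_endo nabla E (E \<cdot> X) Y - nabla_endo nabla E X (E \<cdot> Y))"

definition oneill_T ::
    "('a, 'e::euclidean_space) connection \<Rightarrow> ('a, 'e) endo \<Rightarrow> ('a, 'e) endo \<Rightarrow>
     ('a, 'e) vfield \<Rightarrow> ('a, 'e) vfield \<Rightarrow> ('a, 'e) vfield" where
  "oneill_T nabla v h X Y = h \<cdot> nabla (v \<cdot> X) (v \<cdot> Y) + v \<cdot> nabla (v \<cdot> X) (h \<cdot> Y)"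

definition oneill_A ::
    "('a, 'e::euclidean_space) connection \<Rightarrow> ('a, 'e) endo \<Rightarrow> ('a, 'e) endo \<Rightarrow>
     ('a, 'e) vfield \<Rightarrow> ('a, 'e) vfield \<Rightarrow> ('a, 'e) vfield" where
  "oneill_A nabla v h X Y = v \<cdot> nabla (h \<cdot> X) (h \<cdot> Y) + h \<cdot> nabla (h \<cdot> X) (v \<cdot> Y)"

end

theory Submission
  imports Defs
begin

text \<open>
  Since \<open>v + h\<close> is the identity and \<open>v\<close>, \<open>h\<close> are complementary idempotents, expanding
  \<open>\<nabla>\<^sub>X Y = \<nabla>\<^sub>X (vY) + \<nabla>\<^sub>X (hY)\<close> gives \<open>(\<nabla>\<^sub>X E) Y = 2 (v \<nabla>\<^sub>X (hY) - h \<nabla>\<^sub>X (vY))\<close> for \<open>E = h - v\<close>;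
  both formulas are linear combinations of this identity for \<open>(EX, Y)\<close> and \<open>(X, EY)\<close>. The
  connection is only constrained on smooth vector fields, so the substance lies in the smoothness
  of \<open>vX\<close> and \<open>hX\<close>: locally the two subbundles have smooth frames, which together are independent
  in a chart, and the coefficients of a smooth vector field with respect to a smooth independent
  family are smooth.
\<close>

section \<open>Calculus of smooth maps\<close>

lemma Ck_on_subset: "Ck_on n f S \<Longrightarrow> T \<subseteq> S \<Longrightarrow> Ck_on n f T"
  by (induction n arbitrary: f) (auto intro: continuous_on_subset)

text \<open>The recursion places the extra derivative on the outside, so lowering the order is an
  induction whose base case is that differentiability implies continuity.\<close>

lemma Ck_on_Suc_imp: "Ck_on (Suc n) f S \<Longrightarrow> Ck_on n f S"
proof (induction n arbitrary: f)
  case 0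
  then show ?case
    by (auto intro!: continuous_at_imp_continuous_on differentiable_imp_continuous_within)
next
  case (Suc n)
  then show ?case by (metis Ck_on.simps(2))
qed

text \<open>Derivatives are taken with the full filter \<open>at x\<close>, and on an open
  \<open>T\<close> continuity is a pointwise matter, so every clause of the recursion is
  local.\<close>

lemma Ck_on_local:
  assumes "\<And>x. x \<in> S \<Longrightarrow> \<exists>T. open T \<and> x \<in> T \<and> Ck_on n f T"
  shows "Ck_on n f S"
  using assms
proof (induction n arbitrary: f)
  case 0
  then show ?case
    by (metis Ck_on.simps(1) continuous_at_imp_continuous_on continuous_on_eq_continuous_at)
next
  case (Suc n)
  show ?case
    unfolding Ck_on.simps
  proof (intro conjI ballI allI)
    show "f differentiable (at x)" if "x \<in> S" for x
      using Suc.prems[OF that] by auto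
    show "Ck_on n (\<lambda>x. frechet_derivative f (at x) u) S" for u
      by (rule Suc.IH) (use Suc.prems in fastforce)
  qed
qed

text \<open>Openness of \<open>S\<close> gives \<open>f\<close> and \<open>g\<close> the same
  derivative at each point of \<open>S\<close>; the induction then passes to their directional
  derivatives.\<close>

lemma Ck_on_cong:
  assumes "open S" "\<And>x. x \<in> S \<Longrightarrow> f x = g x" "Ck_on n f S"
  shows "Ck_on n g S"
  using assms(2,3)
proof (induction n arbitrary: f g)
  case 0
  then show ?case by (metis Ck_on.simps(1) continuous_on_cong)
next
  case (Suc n)
  have deriv: "(g has_derivative frechet_derivative f (at x)) (at x)" if "x \<in> S" for x
  proof (rule has_derivative_transform_within_open[OF _ \<open>open S\<close> that])
    show "(f has_derivative frechet_derivative f (at x)) (at x)"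
      using Suc.prems(2) that by (auto simp: frechet_derivative_works)
  qed (use Suc.prems(1) in auto)
  show ?case
    unfolding Ck_on.simps
  proof (intro conjI ballI allI)
    show "g differentiable (at x)" if "x \<in> S" for x
      using deriv[OF that] by (auto simp: differentiable_def)
    show "Ck_on n (\<lambda>x. frechet_derivative g (at x) u) S" for u
      by (rule Suc.IH[of "\<lambda>x. frechet_derivative f (at x) u"])
         (use Suc.prems(2) in \<open>auto simp: frechet_derivative_at[OF deriv, symmetric]\<close>)
  qed
qed

text \<open>Lets an explicit derivative \<open>f'\<close> stand in for
  \<open>frechet_derivative\<close>, so that the usual differentiation rules drive the inductions
  below.\<close>

lemma Ck_on_SucI:
  assumes "open S" and deriv: "\<And>x. x \<in> S \<Longrightarrow> (f has_derivative f' x) (at x)"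
    and f': "\<And>u. Ck_on n (\<lambda>x. f' x u) S"
  shows "Ck_on (Suc n) f S"
  unfolding Ck_on.simps
proof (intro conjI ballI allI)
  show "f differentiable (at x)" if "x \<in> S" for x
    using deriv[OF that] by (auto simp: differentiable_def)
  show "Ck_on n (\<lambda>x. frechet_derivative f (at x) u) S" for u
    by (rule Ck_on_cong[OF \<open>open S\<close> _ f'[of u]])
       (simp add: frechet_derivative_at[OF deriv, symmetric])
qed

lemma Ck_on_has_derivative:
  "Ck_on (Suc n) f S \<Longrightarrow> x \<in> S \<Longrightarrow> (f has_derivative frechet_derivative f (at x)) (at x)"
  by (auto simp: frechet_derivative_works)

lemma Ck_on_const: "Ck_on n (\<lambda>x. c) S"
proof (induction n arbitrary: c)
  case 0
  then show ?case by simp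
next
  case (Suc n)
  then show ?case by simp
qed

lemma Ck_on_add:
  assumes "open S" "Ck_on n f S" "Ck_on n g S"
  shows "Ck_on n (\<lambda>x. f x + g x) S"
  using assms(2,3)
proof (induction n arbitrary: f g)
  case 0
  then show ?case by (simp add: continuous_on_add)
next
  case (Suc n)
  show ?case
    by (rule Ck_on_SucI[OF \<open>open S\<close> has_derivative_add[OF Ck_on_has_derivative[OF Suc.prems(1)]
          Ck_on_has_derivative[OF Suc.prems(2)]]])
       (use Suc in auto)
qed

text \<open>By the Leibniz rule the derivative is a sum of two products of C^n maps, to which the
  induction hypothesis applies. Scalar multiples, inner products and real products are all
  instances.\<close>

lemma (in bounded_bilinear) Ck_on:
  assumes "open S" "Ck_on n f S" "Ck_on n g S"
  shows "Ck_on n (\<lambda>x. prod (f x) (g x)) S"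
  using assms(2,3)
proof (induction n arbitrary: f g)
  case 0
  then show ?case by (simp add: continuous_on)
next
  case (Suc n)
  show ?case
    by (rule Ck_on_SucI[OF \<open>open S\<close> FDERIV[OF Ck_on_has_derivative[OF Suc.prems(1)]
          Ck_on_has_derivative[OF Suc.prems(2)]]])
       (use Suc.prems in \<open>auto intro!: Ck_on_add \<open>open S\<close> Suc.IH Ck_on_Suc_imp[OF Suc.prems(1)]
          Ck_on_Suc_imp[OF Suc.prems(2)]\<close>)
qed

lemma Ck_on_inverse:
  fixes f :: "'a::real_normed_vector \<Rightarrow> real"
  assumes "open S" "Ck_on n f S" "\<And>x. x \<in> S \<Longrightarrow> f x \<noteq> 0"
  shows "Ck_on n (\<lambda>x. inverse (f x)) S"
  using assms(2)
proof (induction n)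
  case 0
  then show ?case using assms(3) by (simp add: continuous_on_inverse)
next
  case (Suc n)
  note IH = Suc.IH[OF Ck_on_Suc_imp[OF Suc.prems]]
  show ?case
  proof (rule Ck_on_SucI[OF \<open>open S\<close>])
    \<comment> \<open>The inverse recurs in its own derivative and is C^n by \<open>IH\<close>. The
      sign is written as a factor \<open>-1\<close> so that the product rule alone settles
      regularity.\<close>
    show "((\<lambda>x. inverse (f x)) has_derivative
        (\<lambda>u. (-1) * (inverse (f x) * frechet_derivative f (at x) u * inverse (f x)))) (at x)"
      if "x \<in> S" for x
      using Deriv.has_derivative_inverse[OF assms(3)[OF that] Ck_on_has_derivative[OF Suc.prems that]]
      by simp
    show "Ck_on n (\<lambda>x. (-1) * (inverse (f x) * frechet_derivative f (at x) u * inverse (f x))) S" for u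
    proof -
      note mult = bounded_bilinear.Ck_on[OF bounded_bilinear_mult \<open>open S\<close>]
      have "Ck_on n (\<lambda>x. frechet_derivative f (at x) u) S"
        using Suc.prems by simp
      then show ?thesis
        by (rule mult[OF Ck_on_const mult[OF mult[OF IH] IH]])
    qed
  qed
qed

section \<open>Closure properties of smooth maps and smooth dependence of coefficients\<close>

lemma smooth_on_subset: "smooth_on f S \<Longrightarrow> T \<subseteq> S \<Longrightarrow> smooth_on f T"
  unfolding smooth_on_def by (blast intro: Ck_on_subset)

lemma smooth_on_cong: "open S \<Longrightarrow> (\<And>x. x \<in> S \<Longrightarrow> f x = g x) \<Longrightarrow> smooth_on f S \<Longrightarrow> smooth_on g S"
  unfolding smooth_on_def using Ck_on_cong[of S f g] by simp

lemma smooth_on_local: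
  "(\<And>x. x \<in> S \<Longrightarrow> \<exists>T. open T \<and> x \<in> T \<and> smooth_on f T) \<Longrightarrow> smooth_on f S"
  unfolding smooth_on_def by (intro allI Ck_on_local) blast

lemma smooth_on_imp_differentiable: "smooth_on f S \<Longrightarrow> x \<in> S \<Longrightarrow> f differentiable (at x)"
  unfolding smooth_on_def by (auto dest: spec[of _ "Suc 0"])

lemma smooth_on_add:
  "open S \<Longrightarrow> smooth_on f S \<Longrightarrow> smooth_on g S \<Longrightarrow> smooth_on (\<lambda>x. f x + g x) S"
  unfolding smooth_on_def by (simp add: Ck_on_add)

lemma smooth_on_const: "smooth_on (\<lambda>x. c) S"
  unfolding smooth_on_def by (simp add: Ck_on_const)

lemma smooth_on_scaleR:
  "open S \<Longrightarrow> smooth_on f S \<Longrightarrow> smooth_on g S \<Longrightarrow> smooth_on (\<lambda>x. f x *\<^sub>R g x) S"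
  unfolding smooth_on_def by (simp add: bounded_bilinear.Ck_on[OF bounded_bilinear_scaleR])

lemma smooth_on_inner:
  "open S \<Longrightarrow> smooth_on f S \<Longrightarrow> smooth_on g S \<Longrightarrow> smooth_on (\<lambda>x. f x \<bullet> g x) S"
  unfolding smooth_on_def by (simp add: bounded_bilinear.Ck_on[OF bounded_bilinear_inner])

lemma smooth_on_divide:
  fixes f g :: "'a::real_normed_vector \<Rightarrow> real"
  assumes "open S" "smooth_on f S" "smooth_on g S" "\<And>x. x \<in> S \<Longrightarrow> g x \<noteq> 0"
  shows "smooth_on (\<lambda>x. f x / g x) S"
  using assms unfolding smooth_on_def divide_inverse
  by (auto intro!: bounded_bilinear.Ck_on[OF bounded_bilinear_mult] Ck_on_inverse)

lemma smooth_on_diff: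
  assumes "open S" "smooth_on f S" "smooth_on g S"
  shows "smooth_on (\<lambda>x. f x - g x) S"
  using smooth_on_add[OF assms(1,2) smooth_on_scaleR[OF assms(1) smooth_on_const assms(3), of "-1"]]
  by simp

lemma smooth_on_sum:
  "open S \<Longrightarrow> (\<And>i. i \<in> I \<Longrightarrow> smooth_on (f i) S) \<Longrightarrow> smooth_on (\<lambda>x. \<Sum>i\<in>I. f i x) S"
  by (induction I rule: infinite_finite_induct) (auto intro: smooth_on_add smooth_on_const)

text \<open>Induction on the family: projecting everything orthogonally to one \<open>u j\<close> keeps the other
  coefficients unchanged, so no matrix has to be inverted.\<close>

lemma smooth_coefficients:
  fixes u :: "'i \<Rightarrow> 'b::real_normed_vector \<Rightarrow> 'c::real_inner"
  assumes "finite I" "open S" "\<And>i. i \<in> I \<Longrightarrow> smooth_on (u i) S" "smooth_on y S"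
    and "\<And>x b. x \<in> S \<Longrightarrow> (\<Sum>i\<in>I. b i *\<^sub>R u i x) = 0 \<Longrightarrow> \<forall>i\<in>I. b i = 0"
    and "\<And>x. x \<in> S \<Longrightarrow> y x = (\<Sum>i\<in>I. a i x *\<^sub>R u i x)"
  shows "\<forall>i\<in>I. smooth_on (a i) S"
  using assms(1,3-)
proof (induction I arbitrary: u y rule: finite_induct)
  case empty
  then show ?case by simp
next
  case (insert j I)
  \<comment> \<open>\<open>c z\<close> is the coefficient of the orthogonal projection of
    \<open>z\<close> onto the line of \<open>u j\<close>, and \<open>P z\<close> is the component
    orthogonal to it.\<close>
  define c where "c z x = z x \<bullet> u j x / (u j x \<bullet> u j x)" for z x
  define P where "P z x = z x - c z x *\<^sub>R u j x" for z x
  have uj: "u j x \<noteq> 0" if "x \<in> S" for x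
    using insert.prems(3)[OF that, of "\<lambda>i. if i = j then 1 else 0"] insert.hyps
    by (auto simp: if_distrib[of "\<lambda>r. r *\<^sub>R _"] sum.delta' cong: if_cong)
  have smooth_c: "smooth_on (c z) S" if "smooth_on z S" for z
    unfolding c_def using uj insert.prems(1) that \<open>open S\<close>
    by (intro smooth_on_divide smooth_on_inner) auto
  have smooth_P: "smooth_on (P z) S" if "smooth_on z S" for z
    unfolding P_def using insert.prems(1) that \<open>open S\<close> smooth_c
    by (intro smooth_on_diff smooth_on_scaleR) auto
  have c_sum: "(\<Sum>i\<in>I. b i * c (u i) x) = c (\<lambda>x. \<Sum>i\<in>I. b i *\<^sub>R u i x) x" for b x
    by (simp add: c_def inner_sum_left sum_divide_distrib)
  have P_sum: "(\<Sum>i\<in>I. b i *\<^sub>R P (u i) x) =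
      (\<Sum>i\<in>I. b i *\<^sub>R u i x) - (\<Sum>i\<in>I. b i * c (u i) x) *\<^sub>R u j x" for b x
    by (simp add: P_def scaleR_diff_right sum_subtractf scaleR_sum_left)
  have aI: "\<forall>i\<in>I. smooth_on (a i) S"
  proof (rule insert.IH)
    show "smooth_on (P (u i)) S" if "i \<in> I" for i
      using that insert.prems(1) smooth_P by auto
    show "smooth_on (P y) S"
      using insert.prems(2) smooth_P by auto
    show "\<forall>i\<in>I. b i = 0" if "x \<in> S" "(\<Sum>i\<in>I. b i *\<^sub>R P (u i) x) = 0" for x b
    proof -
      \<comment> \<open>This value at \<open>j\<close> compensates the multiples of
        \<open>u j\<close> removed by \<open>P\<close>, so a relation among the
        \<open>P (u i)\<close> lifts to a relation among all \<open>u i\<close>.\<close>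
      define b' where "b' = b(j := - (\<Sum>i\<in>I. b i * c (u i) x))"
      have "(\<Sum>i\<in>insert j I. b' i *\<^sub>R u i x) = b' j *\<^sub>R u j x + (\<Sum>i\<in>I. b i *\<^sub>R u i x)"
        using insert.hyps by (auto simp: b'_def intro!: sum.cong)
      also have "\<dots> = 0"
        using that(2) unfolding P_sum by (simp add: b'_def)
      finally have "\<forall>i\<in>insert j I. b' i = 0"
        using insert.prems(3) that(1) by blast
      then show ?thesis
        using insert.hyps by (metis b'_def fun_upd_other insertI2)
    qed
    show "P y x = (\<Sum>i\<in>I. a i x *\<^sub>R P (u i) x)" if "x \<in> S" for x
    proof -
      have y: "y x = a j x *\<^sub>R u j x + (\<Sum>i\<in>I. a i x *\<^sub>R u i x)"
        using insert.prems(4)[OF that] insert.hyps by simp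
      \<comment> \<open>\<open>c\<close> is linear with value 1 on \<open>u j\<close>; hence the
        \<open>u j\<close> terms cancel in \<open>P y\<close>, and the coefficients over
        \<open>I\<close> stay the same.\<close>
      have "c y x = a j x + (\<Sum>i\<in>I. a i x * c (u i) x)"
        unfolding c_sum using uj[OF that] by (simp add: c_def y inner_add_left add_divide_distrib)
      then show ?thesis
        unfolding P_sum by (simp add: P_def y algebra_simps)
    qed
  qed
  \<comment> \<open>Once the coefficients over \<open>I\<close> are smooth, subtracting their part
    from \<open>y\<close> leaves \<open>a j\<close> times \<open>u j\<close>, from which
    \<open>c\<close> reads off \<open>a j\<close>.\<close>
  have "smooth_on (c (\<lambda>x. y x - (\<Sum>i\<in>I. a i x *\<^sub>R u i x))) S"
    using aI insert.prems(1,2) \<open>open S\<close>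
    by (intro smooth_c smooth_on_diff smooth_on_sum smooth_on_scaleR) auto
  moreover have "c (\<lambda>x. y x - (\<Sum>i\<in>I. a i x *\<^sub>R u i x)) x = a j x" if "x \<in> S" for x
    using insert.prems(4)[OF that] insert.hyps uj[OF that] by (simp add: c_def)
  ultimately have "smooth_on (a j) S"
    using smooth_on_cong[OF \<open>open S\<close>] by blast
  with aI show ?case by simp
qed

section \<open>Finite families of vectors\<close>

lemma sum_fun_apply: "(\<Sum>i\<in>I. f i) x = (\<Sum>i\<in>I. f i x)"
  for f :: "'i \<Rightarrow> 'a \<Rightarrow> 'b::comm_monoid_add"
  by (induction I rule: infinite_finite_induct) auto

text \<open>Frames are indexed families while \<open>span\<close> concerns sets; injectivity permits
  the reindexing.\<close>

lemma span_familyE: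
  fixes u :: "'i \<Rightarrow> 'b::real_vector"
  assumes "finite I" "inj_on u I" "y \<in> span (u ` I)"
  obtains a where "y = (\<Sum>i\<in>I. a i *\<^sub>R u i)"
proof -
  obtain b where "y = (\<Sum>w\<in>u ` I. b w *\<^sub>R w)"
    using assms(1,3) by (auto simp: span_finite)
  then show ?thesis
    using that[of "b \<circ> u"] assms(2) by (simp add: sum.reindex)
qed

lemma independent_familyD:
  fixes u :: "'i \<Rightarrow> 'b::real_vector"
  assumes "finite I" "inj_on u I" "independent (u ` I)" "(\<Sum>i\<in>I. a i *\<^sub>R u i) = 0" "i \<in> I"
  shows "a i = 0"
proof -
  have "(\<Sum>w\<in>u ` I. a (inv_into I u w) *\<^sub>R w) = 0"
    using assms(2,4) by (simp add: sum.reindex)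
  from independentD[OF assms(3) _ subset_refl this] show ?thesis
    using assms(1,2,5) by force
qed


section \<open>Charts and tangent spaces\<close>

lemma chart_inv_apply:
  assumes "is_chart M c" "q \<in> fst c"
  shows "chart_inv c (snd c q) = q"
proof -
  have "fst c \<subseteq> topspace M"
    using assms(1) openin_subset by (auto simp: is_chart_def)
  then have "inj_on (snd c) (fst c)"
    using assms(1) homeomorphic_imp_injective_map unfolding is_chart_def
    by (metis topspace_subtopology_subset)
  then show ?thesis
    using assms(2) by (simp add: chart_inv_def)
qed

lemma open_chart_image:
  assumes "is_chart M c" "openin M W"
  shows "open (snd c ` (fst c \<inter> W))"
proof -
  have "open_map (subtopology M (fst c)) (top_of_set (snd c ` fst c)) (snd c)"
    using assms(1) homeomorphic_imp_open_map unfolding is_chart_def by blast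
  moreover have "openin (subtopology M (fst c)) (fst c \<inter> W)"
    using assms(2) by (auto simp: openin_subtopology Int_commute)
  ultimately have "openin (top_of_set (snd c ` fst c)) (snd c ` (fst c \<inter> W))"
    unfolding open_map_def by blast
  then show ?thesis
    using assms(1) openin_open_trans unfolding is_chart_def by blast
qed

text \<open>\<open>frechet_derivative\<close> is picked by choice and is known to be linear only
  where the map is differentiable, hence the restriction to the overlap of the charts.\<close>

lemma linear_transition_derivative:
  assumes "smooth_manifold M \<A>" "c \<in> \<A>" "d \<in> \<A>" "p \<in> fst c \<inter> fst d"
  shows "linear (frechet_derivative (transition c d) (at (snd c p)))"
proof -
  have "smooth_on (transition c d) (snd c ` (fst c \<inter> fst d))"
    using assms by (simp add: smooth_manifold_def)
  then have "transition c d differentiable (at (snd c p))"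
    using smooth_on_imp_differentiable assms(4) by blast
  then show ?thesis
    by (rule linear_frechet_derivative)
qed

lemma tangent_space_diff:
  assumes "smooth_manifold M \<A>" "w \<in> tangent_space \<A> p" "w' \<in> tangent_space \<A> p"
  shows "w - w' \<in> tangent_space \<A> p"
proof -
  have "(w - w') d = frechet_derivative (transition c d) (at (snd c p)) ((w - w') c)"
    if "c \<in> \<A>" "d \<in> \<A>" "p \<in> fst c \<inter> fst d" for c d
  proof -
    have "w d = frechet_derivative (transition c d) (at (snd c p)) (w c)"
      "w' d = frechet_derivative (transition c d) (at (snd c p)) (w' c)"
      using assms(2,3) that unfolding tangent_space_def by blast+
    then show ?thesis
      using linear_diff[OF linear_transition_derivative[OF assms(1) that]] by simp
  qed
  moreover have "(w - w') c = 0" if "\<not> (c \<in> \<A> \<and> p \<in> fst c)" for c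
  proof -
    have "w c = 0" "w' c = 0"
      using assms(2,3) that unfolding tangent_space_def by blast+
    then show ?thesis by simp
  qed
  ultimately show ?thesis
    unfolding tangent_space_def by blast
qed

text \<open>The transformation law carries the coordinates in one chart to all others, and entries
  at charts away from \<open>p\<close> are 0 anyway. Linear independence can therefore be tested in
  a single chart.\<close>

lemma tangent_vector_eq_0:
  assumes "smooth_manifold M \<A>" "w \<in> tangent_space \<A> p" "c \<in> \<A>" "p \<in> fst c" "w c = 0"
  shows "w = 0"
proof
  fix d
  show "w d = 0 d"
  proof (cases "d \<in> \<A> \<and> p \<in> fst d")
    case True
    then have "w d = frechet_derivative (transition c d) (at (snd c p)) (w c)"
      using assms(2-4) unfolding tangent_space_def by blast
    also have "\<dots> = 0"
      using linear_0[OF linear_transition_derivative[OF assms(1,3)]] True assms(4,5) by simp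
    finally show ?thesis by simp
  next
    case False
    then have "w d = 0" using assms(2) unfolding tangent_space_def by blast
    then show ?thesis by simp
  qed
qed

lemma tangent_space_outside:
  assumes "smooth_manifold M \<A>" "p \<notin> topspace M"
  shows "tangent_space \<A> p = {0}"
proof -
  have "p \<notin> fst c" if "c \<in> \<A>" for c
    using assms that by (auto simp: smooth_manifold_def)
  then show ?thesis
    by (auto simp: tangent_space_def)
qed

lemma smooth_section_diff:
  assumes "smooth_manifold M \<A>" "openin M W" "smooth_section \<A> W X" "smooth_section \<A> W Y"
  shows "smooth_section \<A> W (X - Y)"
  unfolding smooth_section_def
proof (intro conjI ballI)
  show "(X - Y) p \<in> tangent_space \<A> p" if "p \<in> W" for p
    using that assms(3,4) tangent_space_diff[OF assms(1)] by (simp add: smooth_section_def)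
  fix c assume "c \<in> \<A>"
  moreover from this have "open (snd c ` (fst c \<inter> W))"
    using open_chart_image[OF _ assms(2)] assms(1) unfolding smooth_manifold_def by blast
  ultimately show "smooth_on (\<lambda>x. (X - Y) (chart_inv c x) c) (snd c ` (fst c \<inter> W))"
    using assms(3,4) by (simp add: smooth_section_def smooth_on_diff)
qed

lemma vector_fields_diff:
  assumes "smooth_manifold M \<A>" "X \<in> vector_fields M \<A>" "Y \<in> vector_fields M \<A>"
  shows "X - Y \<in> vector_fields M \<A>"
  using assms(2,3) tangent_space_diff[OF assms(1)] smooth_section_diff[OF assms(1) openin_topspace]
  by (simp add: vector_fields_def)


section \<open>Projectors of a tangent decomposition\<close>

text \<open>Transfers every fact about the projector onto \<open>V\<close> to the projector onto
  \<open>H\<close>.\<close>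

lemma tangent_decomposition_commute:
  assumes "tangent_decomposition M \<A> V H"
  shows "tangent_decomposition M \<A> H V"
proof -
  have sub: "{a + b | a b. a \<in> A \<and> b \<in> B} \<subseteq> {a + b | a b. a \<in> B \<and> b \<in> A}"
    for A B :: "('a, 'b) tangent set"
  proof clarify
    fix a b assume "a \<in> A" "b \<in> B"
    then show "\<exists>a' b'. a + b = a' + b' \<and> a' \<in> B \<and> b' \<in> A"
      by (intro exI[of _ b] exI[of _ a]) (simp add: add.commute)
  qed
  have eqs: "H p \<inter> V p = V p \<inter> H p"
    "{a + b | a b. a \<in> H p \<and> b \<in> V p} = {a + b | a b. a \<in> V p \<and> b \<in> H p}" for p
    by (rule Int_commute) (rule equalityI[OF sub sub])
  show ?thesis
    using assms unfolding tangent_decomposition_def eqs by (elim conjE) (intro conjI)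
qed

lemma vector_subbundleE:
  assumes "vector_subbundle M \<A> D" "p \<in> topspace M"
  obtains W k F where "openin M W" "p \<in> W" "\<And>i. i < k \<Longrightarrow> smooth_section \<A> W (F i)"
    and "\<And>q. q \<in> W \<Longrightarrow> inj_on (\<lambda>i. F i q) {..<k::nat}"
    and "\<And>q. q \<in> W \<Longrightarrow> independent ((\<lambda>i. F i q) ` {..<k})"
    and "\<And>q. q \<in> W \<Longrightarrow> span ((\<lambda>i. F i q) ` {..<k}) = D q"
proof -
  obtain W k F where "openin M W \<and> p \<in> W \<and> (\<forall>i<k. smooth_section \<A> W (F i)) \<and>
      (\<forall>q\<in>W. inj_on (\<lambda>i. F i q) {..<k::nat} \<and> independent ((\<lambda>i. F i q) ` {..<k}) \<and>
        span ((\<lambda>i. F i q) ` {..<k}) = D q)"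
    using bspec[OF assms(1)[unfolded vector_subbundle_def] assms(2)] by (elim exE)
  then show ?thesis
    by (intro that[of W k F]) simp_all
qed

lemma subspace_vector_subbundle:
  assumes "vector_subbundle M \<A> D" "p \<in> topspace M"
  shows "subspace (D p)"
  using assms by (rule vector_subbundleE) (metis subspace_span)

section \<open>Fibrewise algebra of the projector\<close>

context
  fixes M :: "'a topology" and \<A> :: "('a, 'e::euclidean_space) chart set" and V H
  assumes manifold: "smooth_manifold M \<A>" and dec: "tangent_decomposition M \<A> V H"
begin

lemma subspace_V: "p \<in> topspace M \<Longrightarrow> subspace (V p)"
  and subspace_H: "p \<in> topspace M \<Longrightarrow> subspace (H p)"
  using dec[unfolded tangent_decomposition_def] subspace_vector_subbundle[of M \<A>] by simp_all

lemma decomposition_sum_in: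
  "p \<in> topspace M \<Longrightarrow> a \<in> V p \<Longrightarrow> b \<in> H p \<Longrightarrow> a + b \<in> tangent_space \<A> p"
  using dec unfolding tangent_decomposition_def by blast

lemma V_subset: "p \<in> topspace M \<Longrightarrow> a \<in> V p \<Longrightarrow> a \<in> tangent_space \<A> p"
  using decomposition_sum_in[of p a 0] subspace_0[OF subspace_H] by simp

lemma decompositionE:
  assumes "p \<in> topspace M" "w \<in> tangent_space \<A> p"
  obtains a b where "a \<in> V p" "b \<in> H p" "w = a + b"
  using assms dec unfolding tangent_decomposition_def by blast

lemma decomposition_unique:
  assumes "p \<in> topspace M" "a \<in> V p" "b \<in> H p" "a + b = 0"
  shows "a = 0 \<and> b = 0"
proof -
  have "a = - b"
    using assms(4) by (simp add: eq_neg_iff_add_eq_0)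
  then have "a \<in> V p \<inter> H p"
    using assms subspace_neg[OF subspace_H] by blast
  then have "a = 0"
    using dec assms(1) unfolding tangent_decomposition_def by blast
  then show ?thesis using assms(4) by simp
qed

text \<open>Two decompositions of the same vector differ by opposite elements of \<open>V p\<close>
  and \<open>H p\<close>, which vanish; so the definite description is well defined. The other
  fibrewise properties are read off from this.\<close>

lemma projector_add_eq:
  assumes p: "p \<in> topspace M" and "a \<in> V p" "b \<in> H p"
  shows "projector M V H p (a + b) = a"
proof -
  have "(THE x. x \<in> V p \<and> a + b - x \<in> H p) = a"
  proof (rule the_equality)
    show "a \<in> V p \<and> a + b - a \<in> H p" using assms by simp
    fix x assume x: "x \<in> V p \<and> a + b - x \<in> H p"
    have "x - a \<in> V p"
      by (rule subspace_diff[OF subspace_V[OF p] conjunct1[OF x] assms(2)])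
    moreover have "(a + b - x) - b \<in> H p"
      by (rule subspace_diff[OF subspace_H[OF p] conjunct2[OF x] assms(3)])
    moreover have "(x - a) + ((a + b - x) - b) = 0" by simp
    ultimately have "x - a = 0"
      by (rule decomposition_unique[OF p, THEN conjunct1])
    then show "x = a" by simp
  qed
  then show ?thesis using p by (simp add: projector_def)
qed

lemma projector_in:
  assumes "p \<in> topspace M" "w \<in> tangent_space \<A> p"
  shows "projector M V H p w \<in> V p" and "w - projector M V H p w \<in> H p"
  by (rule decompositionE[OF assms], simp add: projector_add_eq[OF assms(1)])+

lemma projector_V: "p \<in> topspace M \<Longrightarrow> a \<in> V p \<Longrightarrow> projector M V H p a = a"
  using projector_add_eq[of p a 0] subspace_0[OF subspace_H] by simp

lemma projector_H: "p \<in> topspace M \<Longrightarrow> b \<in> H p \<Longrightarrow> projector M V H p b = 0"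
  using projector_add_eq[of p 0 b] subspace_0[OF subspace_V] by simp

lemma projector_add:
  assumes p: "p \<in> topspace M" and w: "w \<in> tangent_space \<A> p" and w': "w' \<in> tangent_space \<A> p"
  shows "projector M V H p (w + w') = projector M V H p w + projector M V H p w'"
proof -
  let ?P = "projector M V H p"
  have "?P w + ?P w' \<in> V p"
    by (rule subspace_add[OF subspace_V[OF p] projector_in(1)[OF p w] projector_in(1)[OF p w']])
  moreover have "(w - ?P w) + (w' - ?P w') \<in> H p"
    by (rule subspace_add[OF subspace_H[OF p] projector_in(2)[OF p w] projector_in(2)[OF p w']])
  moreover have "w + w' = (?P w + ?P w') + ((w - ?P w) + (w' - ?P w'))"
    by simp
  ultimately show ?thesis
    using projector_add_eq[OF p] by (simp only:)
qed

lemma projector_in_tangent_space: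
  assumes "w \<in> tangent_space \<A> p"
  shows "projector M V H p w \<in> tangent_space \<A> p"
proof (cases "p \<in> topspace M")
  case True
  show ?thesis by (rule V_subset[OF True projector_in(1)[OF True assms]])
next
  case False
  then show ?thesis by (simp add: tangent_space_outside[OF manifold] projector_def)
qed

section \<open>Smoothness of projected vector fields\<close>

text \<open>Frames of \<open>V\<close> and \<open>H\<close> near \<open>p\<close> combine, in the
  coordinates of \<open>c\<close>, into an independent smooth family. The coefficients of
  \<open>X\<close> in it are smooth, and the part of the expansion over the frame of
  \<open>V\<close> is the projection.\<close>

lemma projector_smooth_locally:
  assumes X: "X \<in> vector_fields M \<A>" and c: "c \<in> \<A>" and p: "p \<in> fst c"
  shows "\<exists>T. open T \<and> snd c p \<in> T \<and>
    smooth_on (\<lambda>x. (projector M V H \<cdot> X) (chart_inv c x) c) T"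
proof -
  let ?P = "projector M V H"
  have chart: "is_chart M c" and "fst c \<subseteq> topspace M"
    using manifold c by (auto simp: smooth_manifold_def)
  then have ptop: "p \<in> topspace M" using p by blast
  have V: "vector_subbundle M \<A> V" and H: "vector_subbundle M \<A> H"
    using dec by (simp_all add: tangent_decomposition_def)
  obtain W k F where W: "openin M W" "p \<in> W"
    and F: "\<And>i. i < k \<Longrightarrow> smooth_section \<A> W (F i)"
    and F': "\<And>q. q \<in> W \<Longrightarrow> inj_on (\<lambda>i. F i q) {..<k::nat}"
      "\<And>q. q \<in> W \<Longrightarrow> independent ((\<lambda>i. F i q) ` {..<k})"
      "\<And>q. q \<in> W \<Longrightarrow> span ((\<lambda>i. F i q) ` {..<k}) = V q"
    by (rule vector_subbundleE[OF V ptop]) (rule that)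
  obtain W' l G where W': "openin M W'" "p \<in> W'"
    and G: "\<And>i. i < l \<Longrightarrow> smooth_section \<A> W' (G i)"
    and G': "\<And>q. q \<in> W' \<Longrightarrow> inj_on (\<lambda>i. G i q) {..<l::nat}"
      "\<And>q. q \<in> W' \<Longrightarrow> independent ((\<lambda>i. G i q) ` {..<l})"
      "\<And>q. q \<in> W' \<Longrightarrow> span ((\<lambda>i. G i q) ` {..<l}) = H q"
    by (rule vector_subbundleE[OF H ptop]) (rule that)
  define U where "U = W \<inter> W' \<inter> topspace M"
  define T where "T = snd c ` (fst c \<inter> U)"
  have "openin M U" using W W' by (auto simp: U_def)
  then have "open T" unfolding T_def using chart open_chart_image by blast
  have T: "chart_inv c x \<in> fst c" "chart_inv c x \<in> U" if "x \<in> T" for x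
    using that chart_inv_apply[OF chart] by (auto simp: T_def)
  have restrict: "smooth_on (\<lambda>x. Y (chart_inv c x) c) T"
    if "smooth_section \<A> Z Y" "U \<subseteq> Z" for Y Z
  proof (rule smooth_on_subset)
    show "smooth_on (\<lambda>x. Y (chart_inv c x) c) (snd c ` (fst c \<inter> Z))"
      using that(1) c by (simp add: smooth_section_def)
  qed (use that(2) in \<open>auto simp: T_def\<close>)
  have F_smooth: "smooth_on (\<lambda>x. F i (chart_inv c x) c) T" if "i < k" for i
    by (rule restrict[OF F[OF that]]) (auto simp: U_def)
  have G_smooth: "smooth_on (\<lambda>x. G i (chart_inv c x) c) T" if "i < l" for i
    by (rule restrict[OF G[OF that]]) (auto simp: U_def)
  have Xt: "X q \<in> tangent_space \<A> q" for q
    using X by (simp add: vector_fields_def)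
  \<comment> \<open>The coefficients are chosen point by point, with no regularity yet; their
    smoothness comes from \<open>smooth_coefficients\<close>.\<close>
  have "\<exists>a. ?P q (X q) = (\<Sum>i<k. a i *\<^sub>R F i q)" if "q \<in> U" for q
    by (rule span_familyE[of "{..<k}" "\<lambda>i. F i q" "?P q (X q)"])
       (use that F'(1,3)[of q] projector_in(1) Xt in \<open>auto simp: U_def\<close>)
  then obtain a where a: "\<And>q. q \<in> U \<Longrightarrow> ?P q (X q) = (\<Sum>i<k. a q i *\<^sub>R F i q)"
    by metis
  have "\<exists>b. X q - ?P q (X q) = (\<Sum>i<l. b i *\<^sub>R G i q)" if "q \<in> U" for q
    by (rule span_familyE[of "{..<l}" "\<lambda>i. G i q" "X q - ?P q (X q)"])
       (use that G'(1,3)[of q] projector_in(2) Xt in \<open>auto simp: U_def\<close>)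
  then obtain b where b: "\<And>q. q \<in> U \<Longrightarrow> X q - ?P q (X q) = (\<Sum>i<l. b q i *\<^sub>R G i q)"
    by metis
  \<comment> \<open>The disjoint sum indexes both frames at once; \<open>u\<close> gives their
    coordinates in \<open>c\<close> and \<open>e\<close> the matching coefficients of
    \<open>X\<close>.\<close>
  define I where "I = {..<k} <+> {..<l}"
  define u where "u j x = (case j of Inl i \<Rightarrow> F i | Inr i \<Rightarrow> G i) (chart_inv c x) c" for j x
  define e where "e j x = (case j of Inl i \<Rightarrow> a (chart_inv c x) i | Inr i \<Rightarrow> b (chart_inv c x) i)" for j x
  have sum_u: "(\<Sum>j\<in>I. r j *\<^sub>R u j x) =
      ((\<Sum>i<k. r (Inl i) *\<^sub>R F i (chart_inv c x)) + (\<Sum>i<l. r (Inr i) *\<^sub>R G i (chart_inv c x))) c"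
    for r x
    by (simp add: I_def u_def sum.Plus sum_fun_apply)
  have "\<forall>j\<in>I. smooth_on (e j) T"
  proof (rule smooth_coefficients[OF _ \<open>open T\<close>])
    show "finite I" by (simp add: I_def)
    show "smooth_on (u j) T" if "j \<in> I" for j
      using that F_smooth G_smooth by (auto simp: I_def u_def[abs_def])
    show "smooth_on (\<lambda>x. X (chart_inv c x) c) T"
      using X by (intro restrict[of "topspace M"]) (auto simp: vector_fields_def U_def)
    show "X (chart_inv c x) c = (\<Sum>j\<in>I. e j x *\<^sub>R u j x)" if "x \<in> T" for x
    proof -
      have "(\<Sum>i<k. a (chart_inv c x) i *\<^sub>R F i (chart_inv c x)) +
          (\<Sum>i<l. b (chart_inv c x) i *\<^sub>R G i (chart_inv c x)) = X (chart_inv c x)"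
        unfolding a[OF T(2)[OF that], symmetric] b[OF T(2)[OF that], symmetric] by simp
      then show ?thesis
        unfolding sum_u by (simp only: e_def sum.case)
    qed
    \<comment> \<open>A relation between coordinates in \<open>c\<close> is one between tangent
      vectors, since a tangent vector vanishing in one chart is 0. Directness of the sum splits it
      into relations within the two frames.\<close>
    show "\<forall>j\<in>I. r j = 0" if x: "x \<in> T" and 0: "(\<Sum>j\<in>I. r j *\<^sub>R u j x) = 0" for x r
    proof -
      define q where "q = chart_inv c x"
      define s where "s = (\<Sum>i<k. r (Inl i) *\<^sub>R F i q)"
      define t where "t = (\<Sum>i<l. r (Inr i) *\<^sub>R G i q)"
      have q: "q \<in> fst c" "q \<in> W" "q \<in> W'" "q \<in> topspace M"
        using T[OF x] by (auto simp: q_def U_def)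
      have "s \<in> span ((\<lambda>i. F i q) ` {..<k})" "t \<in> span ((\<lambda>i. G i q) ` {..<l})"
        unfolding s_def t_def by (rule span_sum, rule span_scale, rule span_base, simp)+
      then have st: "s \<in> V q" "t \<in> H q"
        using F'(3)[OF q(2)] G'(3)[OF q(3)] by simp_all
      have "(s + t) c = 0"
        using 0 unfolding sum_u s_def t_def q_def by simp
      then have "s + t = 0"
        using tangent_vector_eq_0[OF manifold decomposition_sum_in[OF q(4) st] c q(1)] by blast
      then have "s = 0" "t = 0"
        using decomposition_unique[OF q(4) st] by auto
      have "r (Inl i) = 0" if "i < k" for i
        using independent_familyD[of "{..<k}" "\<lambda>i. F i q" "\<lambda>i. r (Inl i)" i] F'(1,2)[OF q(2)] that \<open>s = 0\<close>
        by (simp add: s_def)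
      moreover have "r (Inr i) = 0" if "i < l" for i
        using independent_familyD[of "{..<l}" "\<lambda>i. G i q" "\<lambda>i. r (Inr i)" i] G'(1,2)[OF q(3)] that \<open>t = 0\<close>
        by (simp add: t_def)
      ultimately show ?thesis by (auto simp: I_def)
    qed
  qed
  then have "smooth_on (\<lambda>x. \<Sum>i<k. e (Inl i) x *\<^sub>R u (Inl i) x) T"
    using \<open>open T\<close> F_smooth
    by (intro smooth_on_sum smooth_on_scaleR) (auto simp: I_def u_def[abs_def])
  then have "smooth_on (\<lambda>x. (?P \<cdot> X) (chart_inv c x) c) T"
  proof (rule smooth_on_cong[OF \<open>open T\<close>, rotated])
    show "(\<Sum>i<k. e (Inl i) x *\<^sub>R u (Inl i) x) = (?P \<cdot> X) (chart_inv c x) c" if "x \<in> T" for x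
      by (simp add: endo_app_def a[OF T(2)[OF that]] sum_fun_apply e_def u_def)
  qed
  moreover have "snd c p \<in> T"
    using p W W' ptop by (auto simp: T_def U_def)
  ultimately show ?thesis using \<open>open T\<close> by blast
qed

text \<open>Makes \<open>v \<cdot> X\<close> and \<open>h \<cdot> X\<close> admissible arguments of
  a connection, whose axioms speak only of smooth fields.\<close>

lemma projector_vector_field:
  assumes "X \<in> vector_fields M \<A>"
  shows "projector M V H \<cdot> X \<in> vector_fields M \<A>"
proof -
  have tangent: "(projector M V H \<cdot> X) p \<in> tangent_space \<A> p" for p
    using assms projector_in_tangent_space by (simp add: endo_app_def vector_fields_def)
  have "smooth_on (\<lambda>x. (projector M V H \<cdot> X) (chart_inv c x) c) (snd c ` (fst c \<inter> topspace M))"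
    if "c \<in> \<A>" for c
    using projector_smooth_locally[OF assms that] by (intro smooth_on_local) auto
  with tangent show ?thesis
    by (simp add: vector_fields_def smooth_section_def)
qed

lemma projector_app_add:
  assumes "X \<in> vector_fields M \<A>" "Y \<in> vector_fields M \<A>"
  shows "projector M V H \<cdot> (X + Y) = projector M V H \<cdot> X + projector M V H \<cdot> Y"
proof
  fix p
  have "X p \<in> tangent_space \<A> p" "Y p \<in> tangent_space \<A> p"
    using assms by (simp_all add: vector_fields_def)
  then show "(projector M V H \<cdot> (X + Y)) p = (projector M V H \<cdot> X + projector M V H \<cdot> Y) p"
    using projector_add[of p "X p" "Y p"]
    by (cases "p \<in> topspace M") (simp_all add: endo_app_def, simp add: projector_def)
qed

end

text \<open>Both orders of the pair \<open>V\<close>, \<open>H\<close> occur here, so the preceding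
  results are instantiated with the decomposition and with its swap.\<close>

lemma projector_app_eq:
  assumes manifold: "smooth_manifold M \<A>" and dec: "tangent_decomposition M \<A> V H"
    and "X \<in> vector_fields M \<A>"
  shows "projector M V H \<cdot> (projector M V H \<cdot> X) = projector M V H \<cdot> X"
    and "projector M V H \<cdot> (projector M H V \<cdot> X) = 0"
    and "projector M V H \<cdot> X + projector M H V \<cdot> X = X"
proof -
  have "projector M V H p (projector M V H p (X p)) = projector M V H p (X p) \<and>
      projector M V H p (projector M H V p (X p)) = 0 \<and>
      projector M V H p (X p) + projector M H V p (X p) = X p" for p
  proof (cases "p \<in> topspace M")
    case True
    obtain a b where ab: "a \<in> V p" "b \<in> H p" "X p = a + b"
      using decompositionE[OF manifold dec True] assms(3) unfolding vector_fields_def by blast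
    have "projector M H V p (X p) = b"
      using projector_add_eq[OF manifold tangent_decomposition_commute[OF dec] True ab(2,1)] ab(3)
      by (simp add: add.commute)
    then show ?thesis
      using ab True by (simp add: projector_add_eq[OF manifold dec] projector_V[OF manifold dec] projector_H[OF manifold dec])
  next
    \<comment> \<open>Off the manifold the field and both projectors take the value 0.\<close>
    case False
    then show ?thesis
      using assms(3) tangent_space_outside[OF manifold] by (auto simp: vector_fields_def projector_def)
  qed
  then show "projector M V H \<cdot> (projector M V H \<cdot> X) = projector M V H \<cdot> X"
    and "projector M V H \<cdot> (projector M H V \<cdot> X) = 0"
    and "projector M V H \<cdot> X + projector M H V \<cdot> X = X"
    by (auto simp: endo_app_def fun_eq_iff)
qed

section \<open>The covariant derivative of an almost product structure\<close>

lemma endo_app_diff_left: "(E - E') \<cdot> Y = E \<cdot> Y - E' \<cdot> Y"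
  by (simp add: endo_app_def fun_eq_iff)

section \<open>Additivity of a linear connection\<close>

lemma linear_connection_closed:
  "linear_connection M \<A> nabla \<Longrightarrow> X \<in> vector_fields M \<A> \<Longrightarrow> Y \<in> vector_fields M \<A> \<Longrightarrow>
    nabla X Y \<in> vector_fields M \<A>"
  by (simp add: linear_connection_def)

lemma linear_connection_add_left:
  "linear_connection M \<A> nabla \<Longrightarrow> X \<in> vector_fields M \<A> \<Longrightarrow> X' \<in> vector_fields M \<A> \<Longrightarrow>
    Y \<in> vector_fields M \<A> \<Longrightarrow> nabla (X + X') Y = nabla X Y + nabla X' Y"
  by (simp add: linear_connection_def)

lemma linear_connection_add_right:
  "linear_connection M \<A> nabla \<Longrightarrow> X \<in> vector_fields M \<A> \<Longrightarrow> Y \<in> vector_fields M \<A> \<Longrightarrow>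
    Y' \<in> vector_fields M \<A> \<Longrightarrow> nabla X (Y + Y') = nabla X Y + nabla X Y'"
  by (simp add: linear_connection_def)

lemma linear_connection_diff_left:
  assumes "smooth_manifold M \<A>" "linear_connection M \<A> nabla"
    and "X \<in> vector_fields M \<A>" "X' \<in> vector_fields M \<A>" "Y \<in> vector_fields M \<A>"
  shows "nabla (X - X') Y = nabla X Y - nabla X' Y"
proof -
  have "nabla (X - X' + X') Y = nabla (X - X') Y + nabla X' Y"
    by (rule linear_connection_add_left[OF assms(2) vector_fields_diff[OF assms(1,3,4)] assms(4,5)])
  then show ?thesis by simp
qed

lemma linear_connection_diff_right:
  assumes "smooth_manifold M \<A>" "linear_connection M \<A> nabla"
    and "X \<in> vector_fields M \<A>" "Y \<in> vector_fields M \<A>" "Y' \<in> vector_fields M \<A>"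
  shows "nabla X (Y - Y') = nabla X Y - nabla X Y'"
proof -
  have "nabla X (Y - Y' + Y') = nabla X (Y - Y') + nabla X Y'"
    by (rule linear_connection_add_right[OF assms(2,3) vector_fields_diff[OF assms(1,4,5)] assms(5)])
  then show ?thesis by simp
qed

text \<open>The \<open>H\<close> component of the derivative of \<open>h \<cdot> Y\<close> and the
  \<open>V\<close> component of that of \<open>v \<cdot> Y\<close> cancel. Only the components by
  which the connection leaves a subbundle survive, each counted twice.\<close>

lemma nabla_endo_decomposition:
  fixes M :: "'a topology" and V H :: "'a \<Rightarrow> ('a, 'e::euclidean_space) tangent set"
  defines "v \<equiv> projector M V H" and "h \<equiv> projector M H V"
  assumes manifold: "smooth_manifold M \<A>" and dec: "tangent_decomposition M \<A> V H"
    and nabla: "linear_connection M \<A> nabla"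
    and X: "X \<in> vector_fields M \<A>" and Y: "Y \<in> vector_fields M \<A>"
  shows "nabla_endo nabla (h - v) X Y =
    2 *\<^sub>R (v \<cdot> nabla X (h \<cdot> Y) - h \<cdot> nabla X (v \<cdot> Y))"
proof -
  note dec' = tangent_decomposition_commute[OF dec]
  have vY: "v \<cdot> Y \<in> vector_fields M \<A>" and hY: "h \<cdot> Y \<in> vector_fields M \<A>"
    using projector_vector_field[OF manifold dec Y] projector_vector_field[OF manifold dec' Y]
    by (simp_all add: v_def h_def)
  define P Q where "P = nabla X (h \<cdot> Y)" and "Q = nabla X (v \<cdot> Y)"
  have PQ: "P \<in> vector_fields M \<A>" "Q \<in> vector_fields M \<A>"
    using linear_connection_closed[OF nabla X] vY hY by (auto simp: P_def Q_def)
  have "h \<cdot> Y + v \<cdot> Y = Y"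
    using projector_app_eq(3)[OF manifold dec' Y] by (simp add: v_def h_def)
  then have sum: "nabla X Y = P + Q"
    using linear_connection_add_right[OF nabla X hY vY] by (simp add: P_def Q_def)
  have diff: "nabla X ((h - v) \<cdot> Y) = P - Q"
    unfolding endo_app_diff_left P_def Q_def
    by (rule linear_connection_diff_right[OF manifold nabla X hY vY])
  have add: "v \<cdot> (P + Q) = v \<cdot> P + v \<cdot> Q" "h \<cdot> (P + Q) = h \<cdot> P + h \<cdot> Q"
    using projector_app_add[OF manifold dec PQ] projector_app_add[OF manifold dec' PQ]
    by (simp_all add: v_def h_def)
  have split: "v \<cdot> P + h \<cdot> P = P" "v \<cdot> Q + h \<cdot> Q = Q"
    using PQ projector_app_eq(3)[OF manifold dec] by (simp_all add: v_def h_def)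
  have "nabla_endo nabla (h - v) X Y = P - Q - (h \<cdot> P + h \<cdot> Q - (v \<cdot> P + v \<cdot> Q))"
    \<comment> \<open>\<open>diff\<close> has to act first: distributing \<open>h - v\<close> over
      its argument inside the connection would destroy the term that it rewrites.\<close>
    unfolding nabla_endo_def diff sum unfolding endo_app_diff_left add ..
  also have "\<dots> = (v \<cdot> P + h \<cdot> P) - (v \<cdot> Q + h \<cdot> Q) - (h \<cdot> P + h \<cdot> Q - (v \<cdot> P + v \<cdot> Q))"
    unfolding split ..
  also have "\<dots> = 2 *\<^sub>R (v \<cdot> P - h \<cdot> Q)"
    by (simp add: scaleR_2)
  finally show ?thesis by (simp add: P_def Q_def)
qed

theorem mainTheorem9:
  fixes M :: "'a topology"
    and \<A> :: "('a, 'e::euclidean_space) chart set"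
    and V H :: "'a \<Rightarrow> ('a, 'e) tangent set"
    and v h :: "('a, 'e) endo"
    and nabla :: "('a, 'e) connection"
  assumes "smooth_manifold M \<A>"
    and "tangent_decomposition M \<A> V H"
    and "v = projector M V H"
    and "h = projector M H V"
    and "linear_connection M \<A> nabla"
    and "X \<in> vector_fields M \<A>"
    and "Y \<in> vector_fields M \<A>"
  shows "structural_tensor nabla (h - v) X Y =
           2 *\<^sub>R (oneill_T nabla v h X (v \<cdot> Y) + oneill_A nabla v h X (h \<cdot> Y)) \<and>
         virtual_tensor nabla (h - v) X Y =
           - 2 *\<^sub>R (oneill_T nabla v h X (h \<cdot> Y) + oneill_A nabla v h X (v \<cdot> Y))"
proof -
  note manifold = assms(1) and dec = assms(2) and nabla = assms(5) and X = assms(6) and Y = assms(7)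
  note dec' = tangent_decomposition_commute[OF dec]
  have v: "v \<cdot> Z \<in> vector_fields M \<A>" "v \<cdot> v \<cdot> Z = v \<cdot> Z" "v \<cdot> h \<cdot> Z = 0"
    and h: "h \<cdot> Z \<in> vector_fields M \<A>" "h \<cdot> h \<cdot> Z = h \<cdot> Z" "h \<cdot> v \<cdot> Z = 0"
    and vh: "v \<cdot> Z + h \<cdot> Z = Z"
    if "Z \<in> vector_fields M \<A>" for Z
    using projector_vector_field[OF manifold dec that] projector_app_eq[OF manifold dec that]
      projector_vector_field[OF manifold dec' that] projector_app_eq[OF manifold dec' that]
    by (simp_all add: assms(3,4))
  \<comment> \<open>Writing the zero field as a difference reduces its smoothness to closure under
    differences.\<close>
  have "h \<cdot> Y - h \<cdot> Y \<in> vector_fields M \<A>"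
    by (rule vector_fields_diff[OF manifold]) (simp_all add: h Y)
  then have 0: "(0 :: ('a, 'e) vfield) \<in> vector_fields M \<A>" by simp
  have v_add: "v \<cdot> (P + Q) = v \<cdot> P + v \<cdot> Q" and h_add: "h \<cdot> (P + Q) = h \<cdot> P + h \<cdot> Q"
    if "P \<in> vector_fields M \<A>" "Q \<in> vector_fields M \<A>" for P Q
    using projector_app_add[OF manifold dec that] projector_app_add[OF manifold dec' that]
    by (simp_all add: assms(3,4))
  have v_diff: "v \<cdot> (P - Q) = v \<cdot> P - v \<cdot> Q" and h_diff: "h \<cdot> (P - Q) = h \<cdot> P - h \<cdot> Q"
    if "P \<in> vector_fields M \<A>" "Q \<in> vector_fields M \<A>" for P Q
    using v_add[OF vector_fields_diff[OF manifold that] that(2)]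
      h_add[OF vector_fields_diff[OF manifold that] that(2)]
    unfolding diff_add_cancel by (simp_all only: add_diff_cancel_right')
  have nabla_0: "nabla Z 0 = 0" if "Z \<in> vector_fields M \<A>" for Z
    using linear_connection_diff_right[OF manifold nabla that 0 0] by simp
  have v0: "v \<cdot> 0 = 0" and h0: "h \<cdot> 0 = 0"
    using v_diff[OF 0 0] h_diff[OF 0 0] by simp_all
  \<comment> \<open>With \<open>P\<close> and \<open>Q\<close> ranging over \<open>v\<close> and
    \<open>h\<close>, these are the four derivatives from which both fundamental tensors are
    built.\<close>
  define K where "K P Q = nabla (P \<cdot> X) (Q \<cdot> Y)" for P Q
  have K: "K P Q \<in> vector_fields M \<A>" if "P \<in> {v, h}" "Q \<in> {v, h}" for P Q
    unfolding K_def using that v(1) h(1) X Y by (auto intro!: linear_connection_closed[OF nabla])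
  have EX: "(h - v) \<cdot> X \<in> vector_fields M \<A>" and EY: "(h - v) \<cdot> Y \<in> vector_fields M \<A>"
    using vector_fields_diff[OF manifold] v(1) h(1) X Y by (simp_all add: endo_app_diff_left)
  \<comment> \<open>Replacing \<open>Y\<close> by its image under \<open>h - v\<close> flips the
    sign of the vertical part only.\<close>
  have vEY: "v \<cdot> (h - v) \<cdot> Y = - (v \<cdot> Y)" and hEY: "h \<cdot> (h - v) \<cdot> Y = h \<cdot> Y"
    using v_diff h_diff v h Y by (simp_all add: endo_app_diff_left)
  have nabla_neg: "nabla X (- (v \<cdot> Y)) = - nabla X (v \<cdot> Y)"
    using linear_connection_diff_right[OF manifold nabla X 0 v(1)[OF Y]] nabla_0[OF X] by simp
  have h_neg: "h \<cdot> (- Z) = - (h \<cdot> Z)" if "Z \<in> vector_fields M \<A>" for Z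
    using h_diff[OF 0 that] h0 by simp
  \<comment> \<open>In the first slot, \<open>h - v\<close> gives the vertical contribution a minus
    sign, whereas \<open>X\<close> itself, as the sum of its two parts, gives a plus sign in
    \<open>XE\<close>.\<close>
  have EXE: "nabla ((h - v) \<cdot> X) (Q \<cdot> Y) = K h Q - K v Q" if "Q \<in> {v, h}" for Q
    unfolding K_def endo_app_diff_left using that v(1) h(1) X Y
    by (intro linear_connection_diff_left[OF manifold nabla]) auto
  have XE: "nabla X (Q \<cdot> Y) = K h Q + K v Q" if "Q \<in> {v, h}" for Q
  proof -
    have "Q \<cdot> Y \<in> vector_fields M \<A>" using that v(1) h(1) Y by auto
    then have "nabla (h \<cdot> X + v \<cdot> X) (Q \<cdot> Y) = K h Q + K v Q"
      unfolding K_def by (intro linear_connection_add_left[OF nabla h(1)[OF X] v(1)[OF X]])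
    then show ?thesis using vh[OF X] by (simp add: add.commute)
  qed
  have 1: "nabla_endo nabla (h - v) ((h - v) \<cdot> X) Y =
      2 *\<^sub>R (v \<cdot> K h h - v \<cdot> K v h - (h \<cdot> K h v - h \<cdot> K v v))"
    using nabla_endo_decomposition[OF manifold dec nabla EX Y]
    by (simp add: assms(3,4)[symmetric] EXE v_diff h_diff K)
  have "nabla_endo nabla (h - v) X ((h - v) \<cdot> Y) =
      2 *\<^sub>R (v \<cdot> nabla X (h \<cdot> Y) + h \<cdot> nabla X (v \<cdot> Y))"
    using nabla_endo_decomposition[OF manifold dec nabla X EY]
    by (simp add: assms(3,4)[symmetric] vEY hEY nabla_neg
        h_neg[OF linear_connection_closed[OF nabla X v(1)[OF Y]]])
  then have 2: "nabla_endo nabla (h - v) X ((h - v) \<cdot> Y) =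
      2 *\<^sub>R (v \<cdot> K h h + v \<cdot> K v h + (h \<cdot> K h v + h \<cdot> K v v))"
    by (simp add: XE v_add h_add K)
  \<comment> \<open>At a projected second argument one of the two summands of each fundamental
    tensor vanishes, because \<open>v\<close> and \<open>h\<close> annihilate each other.\<close>
  have "oneill_T nabla v h X (v \<cdot> Y) = h \<cdot> K v v" "oneill_T nabla v h X (h \<cdot> Y) = v \<cdot> K v h"
    "oneill_A nabla v h X (h \<cdot> Y) = v \<cdot> K h h" "oneill_A nabla v h X (v \<cdot> Y) = h \<cdot> K h v"
    by (simp_all add: oneill_T_def oneill_A_def v h X Y v0 h0 nabla_0 K_def)
  \<comment> \<open>Here \<open>a\<close>, \<open>b\<close>, \<open>c\<close>, \<open>d\<close>
    stand for the four terms of \<open>1\<close> in order. The sum with \<open>2\<close> keeps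
    \<open>a\<close> and \<open>d\<close>, the difference keeps \<open>b\<close> and
    \<open>c\<close>. Scalars are merged first, so that 1/2 and 2 cancel before doubling is
    expanded.\<close>
  moreover have "(1 / 2) *\<^sub>R (2 *\<^sub>R (a - b - (c - d)) + 2 *\<^sub>R (a + b + (c + d))) = 2 *\<^sub>R (d + a)"
    "(1 / 2) *\<^sub>R (2 *\<^sub>R (a - b - (c - d)) - 2 *\<^sub>R (a + b + (c + d))) = - 2 *\<^sub>R (b + c)"
    for a b c d :: "('a, 'e) vfield"
    by (simp_all only: scaleR_add_right[symmetric] scaleR_diff_right[symmetric] scaleR_scaleR)
       (simp_all add: scaleR_2)
  ultimately show ?thesis
    unfolding structural_tensor_def virtual_tensor_def 1 2 by (simp only: simp_thms)
qed

end
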